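(* Let $P$ be a finite poset, and let $P=A\sqcup B$ be a partition of the underlying set of $P$, with $A$ and $B$ carrying the induced orders $\leq_A,\leq_B$. The following are equivalent: (i) There exists an order-preserving map $f:A\to B$ such that $P=(A\sqcup B,\leq_f^+)$ (equality of partial orders). (ii) $A$ is an ideal of $P$, $B$ is a filter of $P$, and for every $a\in A$, the set $U_B(a)=\{b\in B: a\leq_P b\}$ has a minimum.
   Context: Ideal means downward closed subset, filter means upward closed subset. For an order-preserving map $f:A\to B$ between finite posets, $\leq_f^+$ is the partial order on the disjoint union $A\sqcup B$ that restricts to the given orders on $A$ and $B$ and whose only relations between elements of $A$ and $B$ are: for $a\in A$, $b\in B$, $a\leq_f^+ b$ if and only if $f(a)\leq_B b$ (so $b\leq_f^+ a$ never holds). *)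

theory Defs
  imports Main "HOL-Library.FuncSet"
begin

text \<open>
  A poset is a carrier set together with a relation \<open>r\<close> such that \<open>partial_order_on P r\<close>;
  \<open>(x, y) \<in> r\<close> reads \<open>x \<le> y\<close>. The order induced on a subset \<open>A\<close> is \<open>Restr r A\<close>.
\<close>

text \<open>Not the library's \<open>ofilter\<close>, which is a notion of downward closed set.\<close>

definition order_ideal :: "'a set \<Rightarrow> 'a rel \<Rightarrow> 'a set \<Rightarrow> bool" where
  "order_ideal P r I \<longleftrightarrow> I \<subseteq> P \<and> (\<forall>x\<in>I. \<forall>y\<in>P. (y, x) \<in> r \<longrightarrow> y \<in> I)"

definition order_filter :: "'a set \<Rightarrow> 'a rel \<Rightarrow> 'a set \<Rightarrow> bool" where
  "order_filter P r F \<longleftrightarrow> F \<subseteq> P \<and> (\<forall>x\<in>F. \<forall>y\<in>P. (x, y) \<in> r \<longrightarrow> y \<in> F)"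

definition is_minimum :: "'a rel \<Rightarrow> 'a set \<Rightarrow> 'a \<Rightarrow> bool" where
  "is_minimum r S m \<longleftrightarrow> m \<in> S \<and> (\<forall>x\<in>S. (m, x) \<in> r)"

definition upper_part :: "'a rel \<Rightarrow> 'a set \<Rightarrow> 'a \<Rightarrow> 'a set" where
  "upper_part r B a = {b \<in> B. (a, b) \<in> r}"

definition order_preserving :: "'a set \<Rightarrow> 'a rel \<Rightarrow> 'b set \<Rightarrow> 'b rel \<Rightarrow> ('a \<Rightarrow> 'b) \<Rightarrow> bool" where
  "order_preserving A rA B rB f \<longleftrightarrow>
     f \<in> A \<rightarrow> B \<and> monotone_on A (\<lambda>x y. (x, y) \<in> rA) (\<lambda>x y. (x, y) \<in> rB) f"

text \<open>
  The order \<open>\<le>\<^sub>f\<^sup>+\<close> on \<open>A \<squnion> B\<close>, for posets \<open>(A, rA)\<close> and \<open>(B, rB)\<close> whose carriers are disjoint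
  subsets of one type, so that the disjoint union is simply \<open>A \<union> B\<close>.
\<close>

definition glued_order :: "'a set \<Rightarrow> 'a rel \<Rightarrow> 'a set \<Rightarrow> 'a rel \<Rightarrow> ('a \<Rightarrow> 'a) \<Rightarrow> 'a rel" where
  "glued_order A rA B rB f = rA \<union> rB \<union> {(a, b). a \<in> A \<and> b \<in> B \<and> (f a, b) \<in> rB}"

lemma partial_order_on_glued_order:
  assumes A: "partial_order_on A rA" and B: "partial_order_on B rB" and AB: "A \<inter> B = {}"
    and f: "order_preserving A rA B rB f"
  shows "partial_order_on (A \<union> B) (glued_order A rA B rB f)"
proof -
  have sub: "rA \<subseteq> A \<times> A" "rB \<subseteq> B \<times> B" and rf: "refl_on A rA" "refl_on B rB"
    and tr: "trans rA" "trans rB" and as: "antisym rA" "antisym rB"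
    using A B by (auto simp: partial_order_on_def preorder_on_def)
  have fB: "\<And>a. a \<in> A \<Longrightarrow> f a \<in> B"
    and mono: "\<And>x y. (x, y) \<in> rA \<Longrightarrow> (f x, f y) \<in> rB"
    using f sub by (auto simp: order_preserving_def monotone_on_def)
  let ?g = "glued_order A rA B rB f"
  have "?g \<subseteq> (A \<union> B) \<times> (A \<union> B)" and "refl_on (A \<union> B) ?g"
    using sub rf by (auto simp: glued_order_def refl_on_def)
  moreover have "trans ?g"
  proof (rule transI)
    fix x y z assume "(x, y) \<in> ?g" "(y, z) \<in> ?g"
    then show "(x, z) \<in> ?g"
      unfolding glued_order_def using sub AB
      by (auto dest: mono transD[OF tr(1)] transD[OF tr(2)])
  qed
  moreover have "antisym ?g"
  proof (rule antisymI)
    fix x y assume "(x, y) \<in> ?g" "(y, x) \<in> ?g"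
    then show "x = y"
      unfolding glued_order_def using sub AB
      by (auto dest: antisymD[OF as(1)] antisymD[OF as(2)])
  qed
  ultimately show ?thesis
    by (simp add: partial_order_on_def preorder_on_def)
qed

end

theory Submission
  imports Defs
begin

text \<open>
  In \<open>\<le>\<^sub>f\<^sup>+\<close> the elements of \<open>B\<close> above \<open>a \<in> A\<close> form the principal filter of \<open>B\<close> generated by
  \<open>f a\<close>, so \<open>f a\<close> can be read off from the order as their minimum. Conversely, in a
  partial order where each \<open>a \<in> A\<close> has a least upper element \<open>f a\<close> in \<open>B\<close>, transitivity makes
  the comparisons of \<open>a\<close> with \<open>B\<close> exactly those of \<open>f a\<close> with \<open>B\<close>; and passing from \<open>a\<close> to a
  larger \<open>a'\<close> shrinks the set of upper elements, hence raises its minimum, so that \<open>f\<close> is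
  monotone. The ideal condition excludes the one remaining kind of comparison, \<open>b \<le> a\<close>.
\<close>

text \<open>The upper elements of \<open>a\<close> in \<open>B\<close> are upward closed in \<open>B\<close> by transitivity, so once they
  have a minimum they form the principal filter of \<open>B\<close> generated by it.\<close>

lemma rel_iff_minimum_rel:
  assumes "trans r" "is_minimum r (upper_part r B a) m" "b \<in> B"
  shows "(a, b) \<in> r \<longleftrightarrow> (m, b) \<in> r"
  using assms by (auto simp: is_minimum_def upper_part_def dest: transD)

lemma order_preserving_minimum:
  assumes "trans r"
    and min: "\<And>a. a \<in> A \<Longrightarrow> is_minimum r (upper_part r B a) (f a)"
  shows "order_preserving A (Restr r A) B (Restr r B) f"
proof -
  have fB: "f a \<in> B" and above: "(a, f a) \<in> r" if "a \<in> A" for a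
    using min[OF that] by (auto simp: is_minimum_def upper_part_def)
  have "(f x, f y) \<in> r" if "x \<in> A" "y \<in> A" "(x, y) \<in> r" for x y
  proof -
    have "(x, f y) \<in> r"
      using \<open>(x, y) \<in> r\<close> above[OF \<open>y \<in> A\<close>] by (rule transD[OF \<open>trans r\<close>])
    then show ?thesis
      using rel_iff_minimum_rel[OF \<open>trans r\<close> min[OF \<open>x \<in> A\<close>] fB[OF \<open>y \<in> A\<close>]] by simp
  qed
  then show ?thesis
    using fB by (auto simp: order_preserving_def monotone_on_def)
qed

text \<open>Comparisons within \<open>A\<close> and within \<open>B\<close> agree in the two orders, those from \<open>A\<close> to \<open>B\<close>
  agree by the description of principal filters, and an ideal \<open>A\<close> leaves none from \<open>B\<close> to \<open>A\<close>.\<close>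

lemma eq_glued_order_minimum:
  assumes "trans r" and sub: "r \<subseteq> (A \<union> B) \<times> (A \<union> B)"
    and disj: "A \<inter> B = {}" and ideal: "order_ideal (A \<union> B) r A"
    and min: "\<And>a. a \<in> A \<Longrightarrow> is_minimum r (upper_part r B a) (f a)"
  shows "r = glued_order A (Restr r A) B (Restr r B) f"
proof -
  have fB: "f a \<in> B" if "a \<in> A" for a
    using min[OF that] by (auto simp: is_minimum_def upper_part_def)
  have cross: "(a, b) \<in> r \<longleftrightarrow> (f a, b) \<in> r" if "a \<in> A" "b \<in> B" for a b
    using rel_iff_minimum_rel[OF \<open>trans r\<close> min] that by blast
  have down: "(b, a) \<notin> r" if "a \<in> A" "b \<in> B" for a b
    using ideal disj that by (auto simp: order_ideal_def)
  show ?thesis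
    unfolding glued_order_def using sub fB cross down by blast
qed

text \<open>Reflexivity in \<open>B\<close> puts \<open>f a\<close> itself among the upper elements of \<open>a\<close>; it lies below the
  others by the definition of the glued order.\<close>

lemma is_minimum_glued_order:
  assumes "refl_on B rB" and "rA \<subseteq> A \<times> A" "rB \<subseteq> B \<times> B" "A \<inter> B = {}"
    and "f \<in> A \<rightarrow> B" "a \<in> A"
  defines "g \<equiv> glued_order A rA B rB f"
  shows "is_minimum g (upper_part g B a) (f a)"
  using assms(1-6)
  by (auto simp: g_def is_minimum_def upper_part_def glued_order_def refl_on_def)

theorem corollary3p9:
  fixes P A B :: "'a set" and r :: "'a rel"
  assumes "finite P" and "partial_order_on P r"
    and "A \<union> B = P" and "A \<inter> B = {}"
  shows "(\<exists>f. order_preserving A (Restr r A) B (Restr r B) f \<and>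
              r = glued_order A (Restr r A) B (Restr r B) f)
     \<longleftrightarrow> (order_ideal P r A \<and> order_filter P r B \<and>
          (\<forall>a\<in>A. \<exists>m. is_minimum r (upper_part r B a) m))"
    (is "?L \<longleftrightarrow> ?R")
proof
  assume ?L
  then obtain f where f: "f \<in> A \<rightarrow> B"
    and r: "r = glued_order A (Restr r A) B (Restr r B) f"
    by (auto simp: order_preserving_def)
  have no_down: "(b, a) \<notin> r" if "a \<in> A" "b \<in> B" for a b
    using that \<open>A \<inter> B = {}\<close> by (subst r) (auto simp: glued_order_def)
  have "refl_on B (Restr r B)"
    using assms(2,3) by (auto simp: partial_order_on_def preorder_on_def refl_on_def)
  then have "is_minimum r (upper_part r B a) (f a)" if "a \<in> A" for a
    using is_minimum_glued_order[of B "Restr r B" "Restr r A" A f a] f that \<open>A \<inter> B = {}\<close>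
    unfolding r[symmetric] by blast
  moreover have "order_ideal P r A" "order_filter P r B"
    using no_down \<open>A \<union> B = P\<close> by (auto simp: order_ideal_def order_filter_def)
  ultimately show ?R
    by blast
next
  assume R: ?R
  then obtain f where min: "\<And>a. a \<in> A \<Longrightarrow> is_minimum r (upper_part r B a) (f a)"
    by metis
  have "trans r" "r \<subseteq> (A \<union> B) \<times> (A \<union> B)"
    using assms(2,3) by (auto simp: partial_order_on_def preorder_on_def)
  then show ?L
    using order_preserving_minimum[OF _ min] eq_glued_order_minimum[OF _ _ _ _ min]
      R \<open>A \<union> B = P\<close> \<open>A \<inter> B = {}\<close> by blast
qed

end
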